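(* Let the time steps, the grid size $h=1/K$ and the parameter $\gamma>0$ be fixed, and for each small Mach number $M>0$ let $(\rho^n_{i,j},\mathbf v^n_{i,j},\Lambda^n_{i,j})$, $(i,j)\in\{0,\dots,K\}^2$, $n\in\{0,\dots,N\}$, be a solution of the fully discrete scheme (S1)--(S3) with boundary conditions (B1), (B2) described in the context. Assume that, as $M\to0$, $$\rho^n_{i,j}=\rho^n_{0,i,j}+M^2\rho^n_{1,i,j}+o(M^2),\quad \mathbf v^n_{i,j}=\mathbf v^n_{0,i,j}+o(1),\quad \Lambda^n_{i,j}=\Lambda^n_{0,i,j}+M^2\Lambda^n_{1,i,j}+o(M^2),$$ and that the leading-order initial data satisfy, for all $(i,j)\in\{0,\dots,K\}^2$, $$W'(\rho^0_{0,i,j})-\gamma(\Delta_h\rho^0_0)_{i,j}=\text{const},\qquad (\operatorname{div}_h(\rho^0_0\mathbf v^0_0))_{i,j}=0,\qquad \rho^0_{0,i,j}>0,$$ where const means independent of $(i,j)$. Then $$\rho^n_0=\rho^0_0\quad\text{and}\quad \operatorname{div}_h(\rho^n_0\mathbf v^n_0)=0\qquad\text{for all } n\in\{0,\dots,N\}.$$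
   Context: Setting. $\Omega=[0,1]^2$, $K\in\mathbb N$, $h=1/K$; grid functions are indexed by $(i,j)\in\{0,\dots,K\}^2$, corresponding to the points $(ih,jh)$. Times $0=t_0<\dots<t_N=T$, $\tau_n=t_{n+1}-t_n$. $M>0$ is the Mach number, $\gamma>0$ a fixed capillarity coefficient, $\mu_h\ge 0$ an artificial viscosity coefficient. $W\in C^2((0,\infty),[0,\infty))$ is a double-well energy density: there are $0<\alpha<\beta<\infty$ such that $W$ is strictly convex on $(0,\alpha)\cup(\beta,\infty)$ and strictly concave on $(\alpha,\beta)$. It is decomposed as $W=U-V$ with $U,V$ convex $C^2$-functions and $V''\ge\kappa_V>0$. Write $\mathbf v=(u,w)^T$. Difference operators, for a scalar grid function $f$ and a vector grid function $\mathbf f=(f^1,f^2)^T$: $(\nabla_h f)_{i,j}=\frac1{2h}(f_{i+1,j}-f_{i-1,j},\,f_{i,j+1}-f_{i,j-1})^T$; $(\operatorname{div}_h\mathbf f)_{i,j}=\frac1{2h}(f^1_{i+1,j}-f^1_{i-1,j}+f^2_{i,j+1}-f^2_{i,j-1})$; $(\Delta_hf)_{i,j}=\frac1{h^2}(f_{i+1,j}+f_{i-1,j}+f_{i,j+1}+f_{i,j-1}-4f_{i,j})$ (componentwise on vectors); $(\widetilde{\operatorname{div}}_h(\rho\mathbf v\otimes\mathbf v))_{i,j}=\frac1{4h}\big((\mathbf v_{i,j}+\mathbf v_{i+1,j})(\rho_{i,j}u_{i,j}+\rho_{i+1,j}u_{i+1,j})-(\mathbf v_{i,j}+\mathbf v_{i-1,j})(\rho_{i,j}u_{i,j}+\rho_{i-1,j}u_{i-1,j})+(\mathbf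 v_{i,j}+\mathbf v_{i,j+1})(\rho_{i,j}w_{i,j}+\rho_{i,j+1}w_{i,j+1})-(\mathbf v_{i,j}+\mathbf v_{i,j-1})(\rho_{i,j}w_{i,j}+\rho_{i,j-1}w_{i,j-1})\big)$. Scheme, for $(i,j)\in\{0,\dots,K\}^2$ and $n\in\{0,\dots,N-1\}$: (S1) $\rho^{n+1}_{i,j}-\rho^n_{i,j}+\tau_n\operatorname{div}_h(\rho^{n+1}\mathbf v^{n+1})_{i,j}=0$; (S2) $\rho^{n+1}_{i,j}\mathbf v^{n+1}_{i,j}-\rho^n_{i,j}\mathbf v^n_{i,j}+\tau_n\widetilde{\operatorname{div}}_h(\rho^n\mathbf v^n\otimes\mathbf v^n)_{i,j}+\rho^n_{i,j}\frac{\tau_n}{M^2}(\nabla_h\Lambda^{n+1})_{i,j}-\mu_h\tau_n(\Delta_h\mathbf v^n)_{i,j}=\mathbf 0$; (S3) $\Lambda^{n+1}_{i,j}-U'(\rho^{n+1}_{i,j})+V'(\rho^n_{i,j})+\gamma(\Delta_h\rho^{n+1})_{i,j}=0$. Boundary conditions (ghost cells), at all time levels: (B1) $\rho_{-1,j}=\rho_{0,j}$, $\rho_{K+1,j}=\rho_{K,j}$, $\rho_{i,-1}=\rho_{i,0}$, $\rho_{i,K+1}=\rho_{i,K}$, and analogously for $\Lambda$; (B2) $\mathbf v_{-1,j}=-\mathbf v_{0,j}$, $\mathbf v_{K+1,j}=-\mathbf v_{K,j}$, $\mathbf v_{i,-1}=-\mathbf v_{i,0}$, $\mathbf v_{i,K+1}=-\mathbf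 v_{i,K}$. All difference operators use these extensions (also for the leading-order coefficients). *)

theory Defs
  imports "HOL-Analysis.Analysis" "HOL-Library.Landau_Symbols"
begin

definition strictly_convex_on :: "real set \<Rightarrow> (real \<Rightarrow> real) \<Rightarrow> bool" where
  "strictly_convex_on S f \<longleftrightarrow> convex S \<and>
     (\<forall>x\<in>S. \<forall>y\<in>S. \<forall>s. x \<noteq> y \<and> 0 < s \<and> s < 1 \<longrightarrow>
        f (s * x + (1 - s) * y) < s * f x + (1 - s) * f y)"

definition strictly_concave_on :: "real set \<Rightarrow> (real \<Rightarrow> real) \<Rightarrow> bool" where
  "strictly_concave_on S f \<longleftrightarrow> strictly_convex_on S (\<lambda>x. - f x)"

text \<open>On an open set, being continuously differentiable together with one's derivative.\<close>

definition C2_on :: "real set \<Rightarrow> (real \<Rightarrow> real) \<Rightarrow> bool" where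
  "C2_on S f \<longleftrightarrow> f C1_differentiable_on S \<and> deriv f C1_differentiable_on S"

text \<open>Strict convexity on the disconnected set \<open>(0,\<alpha>) \<union> (\<beta>,\<infinity>)\<close> is read as strict convexity on
  each of the two intervals.\<close>

definition double_well :: "(real \<Rightarrow> real) \<Rightarrow> bool" where
  "double_well W \<longleftrightarrow> C2_on {0<..} W \<and> (\<forall>r>0. 0 \<le> W r) \<and>
     (\<exists>\<alpha> \<beta>. 0 < \<alpha> \<and> \<alpha> < \<beta> \<and>
        strictly_convex_on {0<..<\<alpha>} W \<and> strictly_convex_on {\<beta><..} W \<and>
        strictly_concave_on {\<alpha><..<\<beta>} W)"

definition convex_splitting :: "(real \<Rightarrow> real) \<Rightarrow> (real \<Rightarrow> real) \<Rightarrow> (real \<Rightarrow> real) \<Rightarrow> bool" where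
  "convex_splitting W U V \<longleftrightarrow>
     (\<forall>r>0. W r = U r - V r) \<and>
     C2_on {0<..} U \<and> convex_on {0<..} U \<and>
     C2_on {0<..} V \<and> convex_on {0<..} V \<and>
     (\<exists>\<kappa>>0. \<forall>r>0. \<kappa> \<le> deriv (deriv V) r)"

text \<open>A grid function is a function on all of \<open>\<int>\<^sup>2\<close>; only its values at \<open>{-1..K+1} \<times> {-1..K+1}\<close>,
  without the corners, matter. The values at the ghost cells, where one index is \<open>-1\<close> or \<open>K+1\<close>,
  are constrained by the boundary conditions below.\<close>

type_synonym 'a gridfun = "int \<Rightarrow> int \<Rightarrow> 'a"

definition grad_h :: "real \<Rightarrow> real gridfun \<Rightarrow> (real^2) gridfun" where
  "grad_h h f i j = (1 / (2 * h)) *\<^sub>R vector [f (i+1) j - f (i-1) j, f i (j+1) - f i (j-1)]"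

definition div_h :: "real \<Rightarrow> (real^2) gridfun \<Rightarrow> real gridfun" where
  "div_h h f i j =
     (1 / (2 * h)) * (f (i+1) j $ 1 - f (i-1) j $ 1 + f i (j+1) $ 2 - f i (j-1) $ 2)"

definition laplace_h :: "real \<Rightarrow> 'a::real_vector gridfun \<Rightarrow> 'a gridfun" where
  "laplace_h h f i j =
     (1 / h^2) *\<^sub>R (f (i+1) j + f (i-1) j + f i (j+1) + f i (j-1) - 4 *\<^sub>R f i j)"

definition convection_h :: "real \<Rightarrow> real gridfun \<Rightarrow> (real^2) gridfun \<Rightarrow> (real^2) gridfun" where
  "convection_h h \<rho> v i j = (1 / (4 * h)) *\<^sub>R
     ((\<rho> i j * v i j $ 1 + \<rho> (i+1) j * v (i+1) j $ 1) *\<^sub>R (v i j + v (i+1) j)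
    - (\<rho> i j * v i j $ 1 + \<rho> (i-1) j * v (i-1) j $ 1) *\<^sub>R (v i j + v (i-1) j)
    + (\<rho> i j * v i j $ 2 + \<rho> i (j+1) * v i (j+1) $ 2) *\<^sub>R (v i j + v i (j+1))
    - (\<rho> i j * v i j $ 2 + \<rho> i (j-1) * v i (j-1) $ 2) *\<^sub>R (v i j + v i (j-1)))"

definition momentum_h :: "real gridfun \<Rightarrow> (real^2) gridfun \<Rightarrow> (real^2) gridfun" where
  "momentum_h \<rho> v i j = \<rho> i j *\<^sub>R v i j"

definition grid :: "nat \<Rightarrow> (int \<times> int) set" where
  "grid K = {0..int K} \<times> {0..int K}"

definition neumann_bc :: "nat \<Rightarrow> real gridfun \<Rightarrow> bool" where
  "neumann_bc K f \<longleftrightarrow>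
     (\<forall>k\<in>{0..int K}.
        f (-1) k = f 0 k \<and> f (int K + 1) k = f (int K) k \<and>
        f k (-1) = f k 0 \<and> f k (int K + 1) = f k (int K))"

definition no_slip_bc :: "nat \<Rightarrow> (real^2) gridfun \<Rightarrow> bool" where
  "no_slip_bc K f \<longleftrightarrow>
     (\<forall>k\<in>{0..int K}.
        f (-1) k = - f 0 k \<and> f (int K + 1) k = - f (int K) k \<and>
        f k (-1) = - f k 0 \<and> f k (int K + 1) = - f k (int K))"

definition boundary_conditions ::
  "nat \<Rightarrow> nat \<Rightarrow> (nat \<Rightarrow> real gridfun) \<Rightarrow> (nat \<Rightarrow> (real^2) gridfun) \<Rightarrow> (nat \<Rightarrow> real gridfun) \<Rightarrow> bool"
where
  "boundary_conditions K N \<rho> v \<Lambda> \<longleftrightarrow>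
     (\<forall>n\<le>N. neumann_bc K (\<rho> n) \<and> no_slip_bc K (v n) \<and> neumann_bc K (\<Lambda> n))"

text \<open>The energy densities are only defined on \<open>(0,\<infinity>)\<close>. Positivity of the density is therefore part
  of being a solution: without it the terms \<open>U'(\<rho>\<^sup>n\<^sup>+\<^sup>1)\<close> and \<open>V'(\<rho>\<^sup>n)\<close> have no meaning.\<close>

definition scheme_solution ::
  "nat \<Rightarrow> nat \<Rightarrow> (nat \<Rightarrow> real) \<Rightarrow> real \<Rightarrow> real \<Rightarrow> (real \<Rightarrow> real) \<Rightarrow> (real \<Rightarrow> real) \<Rightarrow> real \<Rightarrow>
   (nat \<Rightarrow> real gridfun) \<Rightarrow> (nat \<Rightarrow> (real^2) gridfun) \<Rightarrow> (nat \<Rightarrow> real gridfun) \<Rightarrow> bool"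
where
  "scheme_solution K N t \<gamma> \<mu> U V M \<rho> v \<Lambda> \<longleftrightarrow>
     boundary_conditions K N \<rho> v \<Lambda> \<and>
     (\<forall>n\<le>N. \<forall>(i,j)\<in>grid K. 0 < \<rho> n i j) \<and>
     (\<forall>n<N. \<forall>(i,j)\<in>grid K.
        let h = 1 / real K; \<tau> = t (Suc n) - t n in
          \<rho> (Suc n) i j - \<rho> n i j
            + \<tau> * div_h h (momentum_h (\<rho> (Suc n)) (v (Suc n))) i j = 0 \<and>
          \<rho> (Suc n) i j *\<^sub>R v (Suc n) i j - \<rho> n i j *\<^sub>R v n i j
            + \<tau> *\<^sub>R convection_h h (\<rho> n) (v n) i j
            + (\<rho> n i j * (\<tau> / M^2)) *\<^sub>R grad_h h (\<Lambda> (Suc n)) i j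
            - (\<mu> * \<tau>) *\<^sub>R laplace_h h (v n) i j = 0 \<and>
          \<Lambda> (Suc n) i j - deriv U (\<rho> (Suc n) i j) + deriv V (\<rho> n i j)
            + \<gamma> * laplace_h h (\<rho> (Suc n)) i j = 0)"

end

theory Submission
  imports Defs
begin

text \<open>The proof is an induction on the time level. Suppose that the leading-order density at level
  \<open>n\<close> is \<open>r = \<rho>\<^sup>0\<^sub>0\<close>, and write \<open>s\<close> for the one at level \<open>n+1\<close>. Three limits \<open>M \<rightarrow> 0\<close> are taken.

  \<^item> The momentum balance multiplied by \<open>M\<^sup>2\<close> leaves only \<open>r \<tau> \<nabla>\<^sub>h \<Lambda>\<^sub>0 = 0\<close>. The central difference
    couples only indices of equal parity, but the Neumann reflection identifies the values at \<open>-1\<close>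
    and \<open>0\<close> and so ties the two parity classes together: \<open>\<Lambda>\<^sub>0\<close> is constant.
  \<^item> The mass balance gives \<open>s - r + \<tau> div\<^sub>h (s v) = 0\<close>. As the momentum is odd across the boundary,
    its divergence sums to zero, so \<open>s\<close> and \<open>r\<close> have the same total mass.
  \<^item> In the equation for \<open>\<Lambda>\<close> all terms but \<open>U'(\<rho>\<^sup>n\<^sup>+\<^sup>1)\<close> are known to converge, hence so does this one,
    to some grid function \<open>a\<close>. Subtracting the equilibrium equation of \<open>r\<close> gives
    \<open>a - U'(r) = c + \<gamma> \<Delta>\<^sub>h (s - r)\<close> with a constant \<open>c\<close>.

  The limit \<open>s\<close> of positive densities might vanish somewhere, so \<open>a = U'(s)\<close> is not available.
  Instead, convexity of \<open>U\<close> gives \<open>(U'(\<rho>) - U'(r)) (\<rho> - r) \<ge> 0\<close> for every positive \<open>\<rho>\<close>, and this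
  passes to the limit as \<open>(a - U'(r)) (s - r) \<ge> 0\<close> (lemma \<open>equilibrium_persists\<close>). Summing over the
  grid, the constant \<open>c\<close> disappears by conservation of mass, and summation by parts leaves \<open>0 \<le> - \<gamma> E\<close>,
  where \<open>E\<close> is the sum of the squared forward difference quotients of \<open>s - r\<close>
  (lemma \<open>mean_zero_rigidity\<close>). Therefore \<open>s - r\<close> is constant, and it is zero as it has mean zero.
  Then the mass balance reads \<open>\<tau> div\<^sub>h (s v) = 0\<close>.\<close>


section \<open>Reflecting boundary conditions\<close>

text \<open>The sign \<open>\<sigma> = 1\<close> is the Neumann condition and \<open>\<sigma> = -1\<close> the no-slip condition. With the sign
  as a parameter, the momentum inherits a condition of the same kind from its two factors.\<close>

definition reflecting_bc :: "real \<Rightarrow> nat \<Rightarrow> 'a::real_vector gridfun \<Rightarrow> bool" where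
  "reflecting_bc \<sigma> K f \<longleftrightarrow>
     (\<forall>k\<in>{0..int K}.
        f (-1) k = \<sigma> *\<^sub>R f 0 k \<and> f (int K + 1) k = \<sigma> *\<^sub>R f (int K) k \<and>
        f k (-1) = \<sigma> *\<^sub>R f k 0 \<and> f k (int K + 1) = \<sigma> *\<^sub>R f k (int K))"

lemma neumann_bc_iff_reflecting: "neumann_bc K f \<longleftrightarrow> reflecting_bc 1 K f"
  by (simp add: neumann_bc_def reflecting_bc_def)

lemma no_slip_bc_iff_reflecting: "no_slip_bc K f \<longleftrightarrow> reflecting_bc (-1) K f"
  by (simp add: no_slip_bc_def reflecting_bc_def)

lemma reflecting_bc_momentum:
  assumes "neumann_bc K \<rho>" "no_slip_bc K v"
  shows "reflecting_bc (-1) K (momentum_h \<rho> v)"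
  using assms by (simp add: neumann_bc_def no_slip_bc_def reflecting_bc_def momentum_h_def)

lemma reflecting_bc_diff:
  assumes "reflecting_bc \<sigma> K f" "reflecting_bc \<sigma> K g"
  shows "reflecting_bc \<sigma> K (\<lambda>i j. f i j - g i j)"
  using assms by (simp add: reflecting_bc_def scaleR_diff_right)


section \<open>Summation over the grid\<close>

lemma sum_int_atMost_Suc:
  fixes f :: "int \<Rightarrow> 'a::comm_monoid_add"
  shows "(\<Sum>i=0..int (Suc K). f i) = (\<Sum>i=0..int K. f i) + f (int K + 1)"
proof -
  have "{0..int (Suc K)} = insert (int K + 1) {0..int K}"
    by auto
  then show ?thesis
    by (simp add: add.commute)
qed

lemma sum_grid: "(\<Sum>(i,j)\<in>grid K. f i j) = (\<Sum>i=0..int K. \<Sum>j=0..int K. f i j)"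
  unfolding grid_def by (simp add: sum.cartesian_product)

lemma sum_grid_swap: "(\<Sum>(i,j)\<in>grid K. f i j) = (\<Sum>j=0..int K. \<Sum>i=0..int K. f i j)"
  unfolding sum_grid by (rule sum.swap)

lemma finite_grid [simp]: "finite (grid K)"
  by (simp add: grid_def)

lemma sum_central_difference:
  fixes f :: "int \<Rightarrow> 'a::ab_group_add"
  shows "(\<Sum>i=0..int K. f (i+1) - f (i-1)) = f (int K + 1) + f (int K) - f 0 - f (-1)"
proof (induction K)
  case (Suc K)
  show ?case
    unfolding sum_int_atMost_Suc Suc.IH by (simp add: algebra_simps)
qed simp

lemma sum_by_parts_second_difference:
  fixes f :: "int \<Rightarrow> real"
  shows "(\<Sum>i=0..int K. f i * (f (i+1) + f (i-1) - 2 * f i)) =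
    f (int K) * (f (int K + 1) - f (int K)) - f 0 * (f 0 - f (-1))
      - (\<Sum>i<K. (f (int i + 1) - f (int i))^2)"
proof (induction K)
  case (Suc K)
  show ?case
    unfolding sum_int_atMost_Suc Suc.IH by (simp add: algebra_simps power2_eq_square)
qed (simp add: algebra_simps)

text \<open>The two central differences telescope to boundary terms \<open>f(K+1) + f(K)\<close> and \<open>f(0) + f(-1)\<close>,
  which an odd reflection cancels.\<close>

lemma sum_div_eq_0:
  assumes "reflecting_bc (-1) K m"
  shows "(\<Sum>(i,j)\<in>grid K. div_h h m i j) = 0"
proof -
  let ?A = "\<lambda>i j. m (i+1) j $ 1 - m (i-1) j $ 1" and ?B = "\<lambda>i j. m i (j+1) $ 2 - m i (j-1) $ 2"
  have A: "(\<Sum>(i,j)\<in>grid K. ?A i j) = 0"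
    unfolding sum_grid_swap
  proof (rule sum.neutral, rule ballI)
    fix j assume "j \<in> {0..int K}"
    then show "(\<Sum>i=0..int K. ?A i j) = 0"
      using sum_central_difference[of "\<lambda>i. m i j $ 1" K] assms
      by (simp add: reflecting_bc_def)
  qed
  have B: "(\<Sum>(i,j)\<in>grid K. ?B i j) = 0"
    unfolding sum_grid
  proof (rule sum.neutral, rule ballI)
    fix i assume "i \<in> {0..int K}"
    then show "(\<Sum>j=0..int K. ?B i j) = 0"
      using sum_central_difference[of "\<lambda>j. m i j $ 2" K] assms
      by (simp add: reflecting_bc_def)
  qed
  have "(\<Sum>(i,j)\<in>grid K. div_h h m i j) = (\<Sum>(i,j)\<in>grid K. 1 / (2*h) * (?A i j + ?B i j))"
    by (rule sum.cong) (auto simp: div_h_def algebra_simps)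
  also have "\<dots> = 1 / (2*h) * ((\<Sum>(i,j)\<in>grid K. ?A i j) + (\<Sum>(i,j)\<in>grid K. ?B i j))"
    by (simp only: case_prod_unfold sum.distrib[symmetric] sum_distrib_left)
  finally show ?thesis
    using A B by simp
qed

text \<open>An even reflection makes the normal differences at the boundary vanish, which are the factors of
  the boundary terms in the summation by parts.\<close>

lemma sum_mult_laplace:
  fixes d :: "real gridfun"
  assumes "neumann_bc K d"
  shows "(\<Sum>(i,j)\<in>grid K. d i j * laplace_h h d i j) =
    - (1 / h^2) * ((\<Sum>j=0..int K. \<Sum>i<K. (d (int i + 1) j - d (int i) j)^2)
                 + (\<Sum>i=0..int K. \<Sum>j<K. (d i (int j + 1) - d i (int j))^2))"
proof -
  let ?A = "\<lambda>i j. d i j * (d (i+1) j + d (i-1) j - 2 * d i j)"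
    and ?B = "\<lambda>i j. d i j * (d i (j+1) + d i (j-1) - 2 * d i j)"
  have A: "(\<Sum>(i,j)\<in>grid K. ?A i j) = - (\<Sum>j=0..int K. \<Sum>i<K. (d (int i + 1) j - d (int i) j)^2)"
    unfolding sum_grid_swap sum_negf[symmetric]
  proof (rule sum.cong[OF refl])
    fix j assume "j \<in> {0..int K}"
    then show "(\<Sum>i=0..int K. ?A i j) = (\<Sum>i<K. - ((d (int i + 1) j - d (int i) j)^2))"
      using sum_by_parts_second_difference[of "\<lambda>i. d i j" K] assms
      by (simp add: neumann_bc_def sum_negf)
  qed
  have B: "(\<Sum>(i,j)\<in>grid K. ?B i j) = - (\<Sum>i=0..int K. \<Sum>j<K. (d i (int j + 1) - d i (int j))^2)"
    unfolding sum_grid sum_negf[symmetric]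
  proof (rule sum.cong[OF refl])
    fix i assume "i \<in> {0..int K}"
    then show "(\<Sum>j=0..int K. ?B i j) = (\<Sum>j<K. - ((d i (int j + 1) - d i (int j))^2))"
      using sum_by_parts_second_difference[of "d i" K] assms
      by (simp add: neumann_bc_def sum_negf)
  qed
  have "(\<Sum>(i,j)\<in>grid K. d i j * laplace_h h d i j) = (\<Sum>(i,j)\<in>grid K. 1 / h^2 * (?A i j + ?B i j))"
    by (rule sum.cong) (auto simp: laplace_h_def algebra_simps)
  also have "\<dots> = 1 / h^2 * ((\<Sum>(i,j)\<in>grid K. ?A i j) + (\<Sum>(i,j)\<in>grid K. ?B i j))"
    by (simp only: case_prod_unfold sum.distrib[symmetric] sum_distrib_left)
  finally show ?thesis
    unfolding A B by (simp add: algebra_simps)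
qed

lemma constant_on_grid:
  assumes "\<And>i j. i < K \<Longrightarrow> j \<in> {0..int K} \<Longrightarrow> f (int i + 1) j = f (int i) j"
    and "\<And>i j. j < K \<Longrightarrow> i \<in> {0..int K} \<Longrightarrow> f i (int j + 1) = f i (int j)"
    and "(i,j) \<in> grid K"
  shows "f i j = f 0 0"
proof -
  have ij: "i \<in> {0..int K}" "j \<in> {0..int K}"
    using assms(3) by (auto simp: grid_def)
  have rows: "k \<le> K \<Longrightarrow> f (int k) j = f 0 j" for k
    by (induction k) (use assms(1) ij in \<open>auto simp: add.commute\<close>)
  have cols: "k \<le> K \<Longrightarrow> f 0 (int k) = f 0 0" for k
    by (induction k) (use assms(2) ij in \<open>auto simp: add.commute\<close>)
  show ?thesis
    using rows[of "nat i"] cols[of "nat j"] ij by (simp add: nat_le_iff)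
qed

text \<open>Testing with \<open>d\<close> itself: the constant \<open>c\<close> is orthogonal to \<open>d\<close> and the Laplacian contributes
  minus the Dirichlet energy of \<open>d\<close>, so nonnegativity forces this energy to vanish.\<close>

lemma mean_zero_rigidity:
  fixes d :: "real gridfun"
  assumes bc: "neumann_bc K d" and "h \<noteq> 0" "\<gamma> > 0"
    and mean: "(\<Sum>(i,j)\<in>grid K. d i j) = 0"
    and nonneg: "\<And>i j. (i,j) \<in> grid K \<Longrightarrow> 0 \<le> d i j * (c + \<gamma> * laplace_h h d i j)"
    and ij: "(i,j) \<in> grid K"
  shows "d i j = 0"
proof -
  let ?A = "\<Sum>j=0..int K. \<Sum>i<K. (d (int i + 1) j - d (int i) j)^2"
    and ?B = "\<Sum>i=0..int K. \<Sum>j<K. (d i (int j + 1) - d i (int j))^2"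
  have "0 \<le> (\<Sum>(i,j)\<in>grid K. d i j * (c + \<gamma> * laplace_h h d i j))"
    using nonneg by (intro sum_nonneg) auto
  also have "\<dots> = c * (\<Sum>(i,j)\<in>grid K. d i j) + \<gamma> * (\<Sum>(i,j)\<in>grid K. d i j * laplace_h h d i j)"
    by (simp add: case_prod_unfold sum.distrib[symmetric] sum_distrib_left algebra_simps)
  also have "\<dots> = - (\<gamma> / h^2) * (?A + ?B)"
    unfolding mean sum_mult_laplace[OF bc] by simp
  finally have "?A + ?B \<le> 0"
    using \<open>h \<noteq> 0\<close> \<open>\<gamma> > 0\<close> by (simp add: mult_le_0_iff zero_le_mult_iff divide_le_0_iff zero_le_divide_iff)
  moreover have "0 \<le> ?A" "0 \<le> ?B"
    by (intro sum_nonneg; simp)+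
  ultimately have "?A = 0" "?B = 0"
    by linarith+
  have const: "d k l = d 0 0" if "(k,l) \<in> grid K" for k l
  proof (rule constant_on_grid[OF _ _ that])
    fix i :: nat and j assume "i < K" "j \<in> {0..int K}"
    then show "d (int i + 1) j = d (int i) j"
      using \<open>?A = 0\<close> by (simp add: sum_nonneg_eq_0_iff sum_nonneg)
  next
    fix j :: nat and i assume "j < K" "i \<in> {0..int K}"
    then show "d i (int j + 1) = d i (int j)"
      using \<open>?B = 0\<close> by (simp add: sum_nonneg_eq_0_iff sum_nonneg)
  qed
  have "0 = (\<Sum>p\<in>grid K. d 0 0)"
    using mean const by (smt (verit, best) sum.cong case_prod_unfold prod.collapse)
  also have "\<dots> = real (card (grid K)) * d 0 0"
    by simp
  finally have "d 0 0 = 0"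
    using ij by (auto simp: card_eq_0_iff)
  then show ?thesis
    using const[OF ij] by simp
qed

text \<open>\<open>f(i+1) = f(i-1)\<close> alone would allow checkerboard patterns; starting the recursion at the
  reflected pair \<open>f(-1) = f(0)\<close> excludes them.\<close>

lemma central_difference_zero_imp_constant:
  fixes f :: "int \<Rightarrow> 'a"
  assumes "f (-1) = f 0" and "\<And>i. i \<in> {0..int K} \<Longrightarrow> f (i+1) = f (i-1)"
  shows "i < K \<Longrightarrow> f (int i + 1) = f (int i)"
proof (induction i)
  case 0
  then show ?case
    using assms(1) assms(2)[of 0] by simp
next
  case (Suc i)
  then show ?case
    using assms(2)[of "int i + 1"] by (simp add: add.commute)
qed

lemma grad_zero_imp_constant:
  assumes bc: "neumann_bc K f" and "h \<noteq> 0"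
    and grad: "\<And>i j. (i,j) \<in> grid K \<Longrightarrow> grad_h h f i j = 0"
    and ij: "(i,j) \<in> grid K"
  shows "f i j = f 0 0"
proof (rule constant_on_grid[OF _ _ ij])
  have diffs: "f (k+1) l = f (k-1) l \<and> f k (l+1) = f k (l-1)"
    if "k \<in> {0..int K}" "l \<in> {0..int K}" for k l
    using grad[of k l] that \<open>h \<noteq> 0\<close> by (auto simp: grad_h_def grid_def vec_eq_iff forall_2)
  show "f (int i + 1) j = f (int i) j" if "i < K" "j \<in> {0..int K}" for i j
    by (rule central_difference_zero_imp_constant[where K = K and f = "\<lambda>i. f i j"])
      (use bc diffs that in \<open>auto simp: neumann_bc_def\<close>)
  show "f i (int j + 1) = f i (int j)" if "j < K" "i \<in> {0..int K}" for i j
    by (rule central_difference_zero_imp_constant[where K = K and f = "f i"])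
      (use bc diffs that in \<open>auto simp: neumann_bc_def\<close>)
qed


section \<open>Limits of grid functions\<close>

text \<open>The corners of the ghost layer are left out: no difference operator reads them and no boundary
  condition determines them.\<close>

definition stencil :: "nat \<Rightarrow> (int \<times> int) set" where
  "stencil K = {0..int K} \<times> {-1..int K + 1} \<union> {-1..int K + 1} \<times> {0..int K}"

lemma stencil_of_grid:
  assumes "(i,j) \<in> grid K"
  shows "(i,j) \<in> stencil K" "(i+1,j) \<in> stencil K" "(i-1,j) \<in> stencil K"
    "(i,j+1) \<in> stencil K" "(i,j-1) \<in> stencil K"
  using assms by (auto simp: grid_def stencil_def)

definition grid_tendsto ::
  "nat \<Rightarrow> ('b \<Rightarrow> 'a::topological_space gridfun) \<Rightarrow> 'a gridfun \<Rightarrow> 'b filter \<Rightarrow> bool" where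
  "grid_tendsto K f g F \<longleftrightarrow> (\<forall>(i,j)\<in>stencil K. ((\<lambda>x. f x i j) \<longlongrightarrow> g i j) F)"

lemma grid_tendstoD:
  assumes "grid_tendsto K f g F" "(i,j) \<in> grid K"
  shows "((\<lambda>x. f x i j) \<longlongrightarrow> g i j) F"
    "((\<lambda>x. f x (i+1) j) \<longlongrightarrow> g (i+1) j) F" "((\<lambda>x. f x (i-1) j) \<longlongrightarrow> g (i-1) j) F"
    "((\<lambda>x. f x i (j+1)) \<longlongrightarrow> g i (j+1)) F" "((\<lambda>x. f x i (j-1)) \<longlongrightarrow> g i (j-1)) F"
  using assms(1) stencil_of_grid[OF assms(2)] unfolding grid_tendsto_def by blast+

lemma reflecting_grid_tendsto:
  fixes f :: "'b \<Rightarrow> 'a::real_normed_vector gridfun"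
  assumes f: "\<forall>\<^sub>F x in F. reflecting_bc \<sigma> K (f x)" and g: "reflecting_bc \<sigma> K g"
    and lim: "\<And>i j. (i,j) \<in> grid K \<Longrightarrow> ((\<lambda>x. f x i j) \<longlongrightarrow> g i j) F"
  shows "grid_tendsto K f g F"
proof -
  have reflected: "((\<lambda>x. f x k' l') \<longlongrightarrow> g k' l') F"
    if "(k,l) \<in> grid K" "\<forall>\<^sub>F x in F. f x k' l' = \<sigma> *\<^sub>R f x k l" "g k' l' = \<sigma> *\<^sub>R g k l"
    for k l k' l'
    unfolding that(3) tendsto_cong[OF that(2)] by (intro tendsto_intros lim that(1))
  have "((\<lambda>x. f x i j) \<longlongrightarrow> g i j) F" if "(i,j) \<in> stencil K" for i j
  proof -
    have "i \<in> {0..int K} \<and> j \<in> {0..int K}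
        \<or> i = -1 \<and> j \<in> {0..int K} \<or> i = int K + 1 \<and> j \<in> {0..int K}
        \<or> j = -1 \<and> i \<in> {0..int K} \<or> j = int K + 1 \<and> i \<in> {0..int K}"
      using that unfolding stencil_def mem_Sigma_iff Un_iff atLeastAtMost_iff by presburger
    then consider "(i,j) \<in> grid K" | "i = -1" "j \<in> {0..int K}" | "i = int K + 1" "j \<in> {0..int K}"
      | "j = -1" "i \<in> {0..int K}" | "j = int K + 1" "i \<in> {0..int K}"
      unfolding grid_def by blast
    then show ?thesis
    proof cases
      case 1
      then show ?thesis by (rule lim)
    next
      case 2
      show ?thesis
        by (rule reflected[of 0 j])
          (use 2 f g in \<open>auto simp: grid_def reflecting_bc_def elim: eventually_mono\<close>)
    next
      case 3
      show ?thesis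
        by (rule reflected[of "int K" j])
          (use 3 f g in \<open>auto simp: grid_def reflecting_bc_def elim: eventually_mono\<close>)
    next
      case 4
      show ?thesis
        by (rule reflected[of i 0])
          (use 4 f g in \<open>auto simp: grid_def reflecting_bc_def elim: eventually_mono\<close>)
    next
      case 5
      show ?thesis
        by (rule reflected[of i "int K"])
          (use 5 f g in \<open>auto simp: grid_def reflecting_bc_def elim: eventually_mono\<close>)
    qed
  qed
  then show ?thesis
    unfolding grid_tendsto_def by blast
qed

lemma grid_tendsto_momentum:
  assumes "grid_tendsto K \<rho> \<rho>' F" "grid_tendsto K v v' F"
  shows "grid_tendsto K (\<lambda>x. momentum_h (\<rho> x) (v x)) (momentum_h \<rho>' v') F"
  using assms unfolding grid_tendsto_def momentum_h_def by (auto intro!: tendsto_scaleR)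

lemma tendsto_div_h:
  assumes "grid_tendsto K m m' F" "(i,j) \<in> grid K"
  shows "((\<lambda>x. div_h h (m x) i j) \<longlongrightarrow> div_h h m' i j) F"
  unfolding div_h_def by (intro tendsto_intros grid_tendstoD[OF assms])

lemma tendsto_laplace_h:
  fixes f :: "'b \<Rightarrow> 'a::real_normed_vector gridfun"
  assumes "grid_tendsto K f g F" "(i,j) \<in> grid K"
  shows "((\<lambda>x. laplace_h h (f x) i j) \<longlongrightarrow> laplace_h h g i j) F"
  unfolding laplace_h_def by (intro tendsto_intros grid_tendstoD[OF assms])

lemma tendsto_convection_h:
  assumes "grid_tendsto K \<rho> \<rho>' F" "grid_tendsto K v v' F" "(i,j) \<in> grid K"
  shows "((\<lambda>x. convection_h h (\<rho> x) (v x) i j) \<longlongrightarrow> convection_h h \<rho>' v' i j) F"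
  unfolding convection_h_def
  by (intro tendsto_intros grid_tendstoD[OF assms(1,3)] grid_tendstoD[OF assms(2,3)])

lemma tendsto_grad_h:
  assumes "grid_tendsto K f g F" "(i,j) \<in> grid K"
  shows "((\<lambda>x. grad_h h (f x) i j) \<longlongrightarrow> grad_h h g i j) F"
proof (rule vec_tendstoI)
  fix k :: 2
  have "((\<lambda>x. 1 / (2*h) * (f x (i+1) j - f x (i-1) j)) \<longlongrightarrow> 1 / (2*h) * (g (i+1) j - g (i-1) j)) F"
    "((\<lambda>x. 1 / (2*h) * (f x i (j+1) - f x i (j-1))) \<longlongrightarrow> 1 / (2*h) * (g i (j+1) - g i (j-1))) F"
    by (intro tendsto_intros grid_tendstoD[OF assms])+
  then show "((\<lambda>x. grad_h h (f x) i j $ k) \<longlongrightarrow> grad_h h g i j $ k) F"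
    using exhaust_2[of k] by (elim disjE) (simp_all add: grad_h_def)
qed


section \<open>The energy densities\<close>

lemma C2_onD:
  assumes "C2_on {0<..} f" "r > 0"
  shows "(f has_real_derivative deriv f r) (at r)" "isCont (deriv f) r"
proof -
  have "f differentiable at r" "continuous_on {0<..} (deriv f)"
    using assms by (auto simp: C2_on_def C1_differentiable_on_eq[of f]
        intro: C1_differentiable_imp_continuous_on)
  then show "(f has_real_derivative deriv f r) (at r)" "isCont (deriv f) r"
    using assms(2) by (auto simp: DERIV_deriv_iff_real_differentiable continuous_on_eq_continuous_at)
qed

lemma deriv_mono_of_convex:
  assumes C2: "C2_on {0<..} f" and conv: "convex_on {0<..} f" and "x > 0" "y > 0"
  shows "0 \<le> (deriv f x - deriv f y) * (x - y)"
proof -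
  have tangent: "deriv f a * (b - a) \<le> f b - f a" if "a > 0" "b > 0" for a b
    using convex_on_imp_above_tangent[OF conv, of a b "deriv f a"] C2_onD(1)[OF C2 that(1)] that
    by (simp add: interior_open has_field_derivative_at_within)
  show ?thesis
    using tangent[of x y] tangent[of y x] assms by (simp add: algebra_simps)
qed

lemma deriv_convex_splitting:
  assumes "convex_splitting W U V" "r > 0"
  shows "deriv W r = deriv U r - deriv V r"
proof -
  have "\<forall>\<^sub>F x in nhds r. W x = U x - V x"
    using assms by (intro eventually_mono[OF eventually_nhds_in_open[of "{0<..}"]])
      (auto simp: convex_splitting_def)
  then have "deriv W r = deriv (\<lambda>x. U x - V x) r"
    by (rule deriv_cong_ev) simp
  also have "\<dots> = deriv U r - deriv V r"
    using assms by (intro DERIV_imp_deriv DERIV_diff C2_onD) (auto simp: convex_splitting_def)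
  finally show ?thesis .
qed


section \<open>The leading-order equations\<close>

lemma tendsto_of_expansion:
  fixes f :: "real \<Rightarrow> real"
  assumes "(\<lambda>M. f M - (a + M^2 * b)) \<in> o[at_right 0](\<lambda>M. M^2)"
  shows "(f \<longlongrightarrow> a) (at_right 0)"
proof -
  have "((\<lambda>M. M^2) \<longlongrightarrow> 0^2) (at_right (0::real))"
    by (intro tendsto_intros)
  then have sq: "((\<lambda>M. M^2) \<longlongrightarrow> 0) (at_right (0::real))"
    by simp
  have "((\<lambda>M. (f M - (a + M^2 * b)) / M^2 * M^2) \<longlongrightarrow> 0 * 0) (at_right 0)"
    by (intro tendsto_mult smalloD_tendsto[OF assms] sq)
  moreover have "\<forall>\<^sub>F M in at_right 0. (f M - (a + M^2 * b)) / M^2 * M^2 = f M - (a + M^2 * b)"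
    using eventually_at_right_less[of "0::real"] by eventually_elim simp
  ultimately have "((\<lambda>M. f M - (a + M^2 * b)) \<longlongrightarrow> 0) (at_right 0)"
    using Lim_transform_eventually by fastforce
  from tendsto_add[OF this tendsto_add[OF tendsto_const[of a] tendsto_mult[OF sq tendsto_const[of b]]]]
  show ?thesis
    by simp
qed

lemma mass_balance_limit:
  assumes "F \<noteq> bot" and \<rho>: "grid_tendsto K \<rho> r F" and \<rho>': "grid_tendsto K \<rho>' s F"
    and v': "grid_tendsto K v' z F" and ij: "(i,j) \<in> grid K"
    and eq: "\<forall>\<^sub>F x in F. \<rho>' x i j - \<rho> x i j + \<tau> * div_h h (momentum_h (\<rho>' x) (v' x)) i j = 0"
  shows "s i j - r i j + \<tau> * div_h h (momentum_h s z) i j = 0"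
proof (rule tendsto_unique[OF \<open>F \<noteq> bot\<close>])
  show "((\<lambda>x. \<rho>' x i j - \<rho> x i j + \<tau> * div_h h (momentum_h (\<rho>' x) (v' x)) i j)
    \<longlongrightarrow> s i j - r i j + \<tau> * div_h h (momentum_h s z) i j) F"
    by (intro tendsto_intros tendsto_div_h[OF _ ij] grid_tendsto_momentum
        grid_tendstoD[OF \<rho> ij] grid_tendstoD[OF \<rho>' ij] \<rho>' v')
  show "((\<lambda>x. \<rho>' x i j - \<rho> x i j + \<tau> * div_h h (momentum_h (\<rho>' x) (v' x)) i j) \<longlongrightarrow> 0) F"
    using eq by (simp add: tendsto_eventually)
qed

text \<open>After multiplication by \<open>M\<^sup>2\<close> the pressure term is the only one of order \<open>1\<close>.\<close>

lemma momentum_balance_limit: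
  assumes \<rho>: "grid_tendsto K \<rho> r (at_right 0)" and \<rho>': "grid_tendsto K \<rho>' s (at_right 0)"
    and v: "grid_tendsto K v y (at_right 0)" and v': "grid_tendsto K v' z (at_right 0)"
    and \<Lambda>': "grid_tendsto K \<Lambda>' l (at_right 0)"
    and ij: "(i,j) \<in> grid K" and "r i j \<noteq> 0" "\<tau> \<noteq> 0"
    and eq: "\<forall>\<^sub>F M in at_right 0. \<rho>' M i j *\<^sub>R v' M i j - \<rho> M i j *\<^sub>R v M i j
            + \<tau> *\<^sub>R convection_h h (\<rho> M) (v M) i j
            + (\<rho> M i j * (\<tau> / M^2)) *\<^sub>R grad_h h (\<Lambda>' M) i j
            - (\<mu> * \<tau>) *\<^sub>R laplace_h h (v M) i j = 0"
  shows "grad_h h l i j = 0"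
proof -
  define B where "B M = \<rho>' M i j *\<^sub>R v' M i j - \<rho> M i j *\<^sub>R v M i j
    + \<tau> *\<^sub>R convection_h h (\<rho> M) (v M) i j - (\<mu> * \<tau>) *\<^sub>R laplace_h h (v M) i j" for M
  define b where "b = s i j *\<^sub>R z i j - r i j *\<^sub>R y i j
    + \<tau> *\<^sub>R convection_h h r y i j - (\<mu> * \<tau>) *\<^sub>R laplace_h h y i j"
  let ?G = "\<lambda>M. M^2 *\<^sub>R B M + (\<rho> M i j * \<tau>) *\<^sub>R grad_h h (\<Lambda>' M) i j"
  have "(B \<longlongrightarrow> b) (at_right 0)"
    unfolding B_def b_def
    by (intro tendsto_intros tendsto_convection_h[OF \<rho> v ij] tendsto_laplace_h[OF v ij]
        grid_tendstoD[OF \<rho> ij] grid_tendstoD[OF \<rho>' ij] grid_tendstoD[OF v ij] grid_tendstoD[OF v' ij])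
  then have "(?G \<longlongrightarrow> 0^2 *\<^sub>R b + (r i j * \<tau>) *\<^sub>R grad_h h l i j) (at_right 0)"
    by (intro tendsto_intros tendsto_grad_h[OF \<Lambda>' ij] grid_tendstoD[OF \<rho> ij])
  moreover have "\<forall>\<^sub>F M in at_right 0. ?G M = 0"
    using eq eventually_at_right_less[of "0::real"]
  proof eventually_elim
    case (elim M)
    have "?G M = M^2 *\<^sub>R (B M + (\<rho> M i j * (\<tau> / M^2)) *\<^sub>R grad_h h (\<Lambda>' M) i j)"
      using elim(2) by (simp add: scaleR_add_right)
    also have "B M + (\<rho> M i j * (\<tau> / M^2)) *\<^sub>R grad_h h (\<Lambda>' M) i j = 0"
      using elim(1) by (simp add: B_def algebra_simps)
    finally show ?case
      by simp
  qed
  then have "(?G \<longlongrightarrow> 0) (at_right 0)"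
    by (rule tendsto_eventually)
  ultimately have "0^2 *\<^sub>R b + (r i j * \<tau>) *\<^sub>R grad_h h l i j = 0"
    using tendsto_unique trivial_limit_at_right_real by blast
  then show ?thesis
    using \<open>r i j \<noteq> 0\<close> \<open>\<tau> \<noteq> 0\<close> by simp
qed

text \<open>The equilibrium equation of \<open>r\<close> and the limit equation of \<open>s\<close> differ by
  \<open>a - U'(r) = l0 - c + \<gamma> \<Delta>\<^sub>h (s - r)\<close> with \<open>a = lim U'(\<rho>')\<close>. The left-hand side has the sign of
  \<open>s - r\<close>: this comes from the monotonicity of \<open>U'\<close> between the positive densities \<open>\<rho>'\<close> and \<open>r\<close>, before
  the limit is taken, since \<open>s\<close> itself may have zeros. Then \<open>mean_zero_rigidity\<close> applies to \<open>s - r\<close>.\<close>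

lemma equilibrium_persists:
  assumes "F \<noteq> bot" "h \<noteq> 0" "\<gamma> > 0" and UV: "convex_splitting W U V"
    and bc: "neumann_bc K r" "neumann_bc K s"
    and \<rho>: "grid_tendsto K \<rho> r F" and \<rho>': "grid_tendsto K \<rho>' s F" and \<Lambda>': "grid_tendsto K \<Lambda>' l F"
    and pos: "\<And>i j. (i,j) \<in> grid K \<Longrightarrow> r i j > 0"
    and pos': "\<And>i j. (i,j) \<in> grid K \<Longrightarrow> \<forall>\<^sub>F x in F. \<rho>' x i j > 0"
    and eq: "\<And>i j. (i,j) \<in> grid K \<Longrightarrow>
      \<forall>\<^sub>F x in F. \<Lambda>' x i j - deriv U (\<rho>' x i j) + deriv V (\<rho> x i j) + \<gamma> * laplace_h h (\<rho>' x) i j = 0"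
    and l: "\<And>i j. (i,j) \<in> grid K \<Longrightarrow> l i j = l0"
    and equilibrium: "\<And>i j. (i,j) \<in> grid K \<Longrightarrow> deriv W (r i j) - \<gamma> * laplace_h h r i j = c"
    and mass: "(\<Sum>(i,j)\<in>grid K. s i j - r i j) = 0"
    and ij: "(i,j) \<in> grid K"
  shows "s i j = r i j"
proof -
  let ?d = "\<lambda>i j. s i j - r i j"
  have "0 \<le> ?d k m * (l0 - c + \<gamma> * laplace_h h ?d k m)" if km: "(k,m) \<in> grid K" for k m
  proof -
    let ?a = "l k m + deriv V (r k m) + \<gamma> * laplace_h h s k m"
    have "C2_on {0<..} V" and U: "C2_on {0<..} U" "convex_on {0<..} U"
      using UV by (auto simp: convex_splitting_def)
    have lim: "((\<lambda>x. \<rho>' x k m) \<longlongrightarrow> s k m) F"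
      by (rule grid_tendstoD[OF \<rho>' km])
    have "((\<lambda>x. deriv V (\<rho> x k m)) \<longlongrightarrow> deriv V (r k m)) F"
      by (rule isCont_tendsto_compose[OF C2_onD(2)[OF \<open>C2_on {0<..} V\<close> pos[OF km]]])
        (rule grid_tendstoD[OF \<rho> km])
    then have "((\<lambda>x. \<Lambda>' x k m + deriv V (\<rho> x k m) + \<gamma> * laplace_h h (\<rho>' x) k m) \<longlongrightarrow> ?a) F"
      by (intro tendsto_intros grid_tendstoD[OF \<Lambda>' km] tendsto_laplace_h[OF \<rho>' km])
    moreover have "\<forall>\<^sub>F x in F. \<Lambda>' x k m + deriv V (\<rho> x k m) + \<gamma> * laplace_h h (\<rho>' x) k m
        = deriv U (\<rho>' x k m)"
      using eq[OF km] by eventually_elim simp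
    ultimately have "((\<lambda>x. deriv U (\<rho>' x k m)) \<longlongrightarrow> ?a) F"
      by (rule Lim_transform_eventually)
    then have "((\<lambda>x. (deriv U (\<rho>' x k m) - deriv U (r k m)) * (\<rho>' x k m - r k m))
        \<longlongrightarrow> (?a - deriv U (r k m)) * ?d k m) F"
      by (intro tendsto_intros lim)
    moreover have "\<forall>\<^sub>F x in F. 0 \<le> (deriv U (\<rho>' x k m) - deriv U (r k m)) * (\<rho>' x k m - r k m)"
      using pos'[OF km] by eventually_elim (rule deriv_mono_of_convex[OF U _ pos[OF km]])
    ultimately have "0 \<le> (?a - deriv U (r k m)) * ?d k m"
      using \<open>F \<noteq> bot\<close> by (rule tendsto_lowerbound)
    moreover have "deriv U (r k m) = deriv V (r k m) + \<gamma> * laplace_h h r k m + c"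
      using equilibrium[OF km] deriv_convex_splitting[OF UV pos[OF km]] by simp
    moreover have "laplace_h h ?d k m = laplace_h h s k m - laplace_h h r k m"
      by (simp add: laplace_h_def algebra_simps diff_divide_distrib add_divide_distrib)
    ultimately show ?thesis
      using l[OF km] by (simp only:) (simp add: algebra_simps)
  qed
  moreover have "neumann_bc K ?d"
    using bc reflecting_bc_diff[of 1 K s r] by (simp add: neumann_bc_iff_reflecting)
  ultimately have "?d i j = 0"
    by (intro mean_zero_rigidity[OF _ \<open>h \<noteq> 0\<close> \<open>\<gamma> > 0\<close> mass _ ij])
  then show ?thesis
    by simp
qed


theorem lemma4p5:
  fixes K N :: nat and h T \<gamma> \<mu> :: real and t :: "nat \<Rightarrow> real"
    and W U V :: "real \<Rightarrow> real"
    and \<rho> \<Lambda> :: "real \<Rightarrow> nat \<Rightarrow> real gridfun" and v :: "real \<Rightarrow> nat \<Rightarrow> (real^2) gridfun"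
    and \<rho>0 \<rho>1 \<Lambda>0 \<Lambda>1 :: "nat \<Rightarrow> real gridfun" and v0 :: "nat \<Rightarrow> (real^2) gridfun"
  assumes K: "K \<ge> 1" and h: "h = 1 / real K"
    and times: "t 0 = 0" "\<forall>n<N. t n < t (Suc n)" "t N = T"
    and \<gamma>: "\<gamma> > 0" and \<mu>: "\<mu> \<ge> 0"
    and W: "double_well W" and UV: "convex_splitting W U V"
    and sol: "\<forall>\<^sub>F M in at_right 0. scheme_solution K N t \<gamma> \<mu> U V M (\<rho> M) (v M) (\<Lambda> M)"
    and coeff_bc: "boundary_conditions K N \<rho>0 v0 \<Lambda>0"
    and \<rho>_exp: "\<forall>n\<le>N. \<forall>(i,j)\<in>grid K.
      (\<lambda>M. \<rho> M n i j - (\<rho>0 n i j + M^2 * \<rho>1 n i j)) \<in> o[at_right 0](\<lambda>M. M^2)"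
    and v_exp: "\<forall>n\<le>N. \<forall>(i,j)\<in>grid K.
      (\<lambda>M. norm (v M n i j - v0 n i j)) \<in> o[at_right 0](\<lambda>M. 1)"
    and \<Lambda>_exp: "\<forall>n\<le>N. \<forall>(i,j)\<in>grid K.
      (\<lambda>M. \<Lambda> M n i j - (\<Lambda>0 n i j + M^2 * \<Lambda>1 n i j)) \<in> o[at_right 0](\<lambda>M. M^2)"
    and init_const: "\<exists>c. \<forall>(i,j)\<in>grid K. deriv W (\<rho>0 0 i j) - \<gamma> * laplace_h h (\<rho>0 0) i j = c"
    and init_div: "\<forall>(i,j)\<in>grid K. div_h h (momentum_h (\<rho>0 0) (v0 0)) i j = 0"
    and init_pos: "\<forall>(i,j)\<in>grid K. \<rho>0 0 i j > 0"
  shows "\<forall>n\<le>N. \<forall>(i,j)\<in>grid K.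
    \<rho>0 n i j = \<rho>0 0 i j \<and> div_h h (momentum_h (\<rho>0 n) (v0 n)) i j = 0"
proof -
  have "h \<noteq> 0"
    using K h by simp
  have ev_bc: "\<forall>\<^sub>F M in at_right 0. reflecting_bc 1 K (\<rho> M n)"
      "\<forall>\<^sub>F M in at_right 0. reflecting_bc (-1) K (v M n)"
      "\<forall>\<^sub>F M in at_right 0. reflecting_bc 1 K (\<Lambda> M n)" if "n \<le> N" for n
    using sol by (eventually_elim; use that in \<open>simp add: scheme_solution_def boundary_conditions_def
      neumann_bc_iff_reflecting no_slip_bc_iff_reflecting\<close>)+
  have lims: "grid_tendsto K (\<lambda>M. \<rho> M n) (\<rho>0 n) (at_right 0)"
      "grid_tendsto K (\<lambda>M. v M n) (v0 n) (at_right 0)"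
      "grid_tendsto K (\<lambda>M. \<Lambda> M n) (\<Lambda>0 n) (at_right 0)" if "n \<le> N" for n
  proof -
    note ev = ev_bc[OF that]
    have bc: "reflecting_bc 1 K (\<rho>0 n)" "reflecting_bc (-1) K (v0 n)" "reflecting_bc 1 K (\<Lambda>0 n)"
      using coeff_bc that by (auto simp: boundary_conditions_def
          neumann_bc_iff_reflecting no_slip_bc_iff_reflecting)
    show "grid_tendsto K (\<lambda>M. \<rho> M n) (\<rho>0 n) (at_right 0)"
      using \<rho>_exp that by (intro reflecting_grid_tendsto[OF ev(1) bc(1)] tendsto_of_expansion) blast
    show "grid_tendsto K (\<lambda>M. \<Lambda> M n) (\<Lambda>0 n) (at_right 0)"
      using \<Lambda>_exp that by (intro reflecting_grid_tendsto[OF ev(3) bc(3)] tendsto_of_expansion) blast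
    show "grid_tendsto K (\<lambda>M. v M n) (v0 n) (at_right 0)"
    proof (rule reflecting_grid_tendsto[OF ev(2) bc(2)])
      fix i j assume "(i,j) \<in> grid K"
      then have "(\<lambda>M. norm (v M n i j - v0 n i j)) \<in> o[at_right 0](\<lambda>M. 1)"
        using v_exp that by blast
      from smalloD_tendsto[OF this] show "((\<lambda>M. v M n i j) \<longlongrightarrow> v0 n i j) (at_right 0)"
        by (simp add: tendsto_norm_zero_iff Lim_null[symmetric])
    qed
  qed
  obtain c where c: "\<And>i j. (i,j) \<in> grid K \<Longrightarrow> deriv W (\<rho>0 0 i j) - \<gamma> * laplace_h h (\<rho>0 0) i j = c"
    using init_const by blast
  have step: "\<forall>(i,j)\<in>grid K. \<rho>0 (Suc n) i j = \<rho>0 0 i j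
      \<and> div_h h (momentum_h (\<rho>0 (Suc n)) (v0 (Suc n))) i j = 0"
    if n: "n < N" and IH: "\<forall>(i,j)\<in>grid K. \<rho>0 n i j = \<rho>0 0 i j" for n
  proof -
    define \<tau> where "\<tau> = t (Suc n) - t n"
    have "\<tau> > 0"
      using times(2) n by (simp add: \<tau>_def)
    have le: "n \<le> N" "Suc n \<le> N"
      using n by auto
    have bc: "neumann_bc K (\<rho>0 0)" "neumann_bc K (\<rho>0 (Suc n))"
        "neumann_bc K (\<Lambda>0 (Suc n))" "no_slip_bc K (v0 (Suc n))"
      using coeff_bc le by (auto simp: boundary_conditions_def)
    have scheme_at: "0 < \<rho> M (Suc n) i j \<and>
        \<rho> M (Suc n) i j - \<rho> M n i j
            + \<tau> * div_h h (momentum_h (\<rho> M (Suc n)) (v M (Suc n))) i j = 0 \<and>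
        \<rho> M (Suc n) i j *\<^sub>R v M (Suc n) i j - \<rho> M n i j *\<^sub>R v M n i j
            + \<tau> *\<^sub>R convection_h h (\<rho> M n) (v M n) i j
            + (\<rho> M n i j * (\<tau> / M^2)) *\<^sub>R grad_h h (\<Lambda> M (Suc n)) i j
            - (\<mu> * \<tau>) *\<^sub>R laplace_h h (v M n) i j = 0 \<and>
        \<Lambda> M (Suc n) i j - deriv U (\<rho> M (Suc n) i j) + deriv V (\<rho> M n i j)
            + \<gamma> * laplace_h h (\<rho> M (Suc n)) i j = 0"
      if "scheme_solution K N t \<gamma> \<mu> U V M (\<rho> M) (v M) (\<Lambda> M)" "(i,j) \<in> grid K" for M i j
      using that n le unfolding scheme_solution_def Let_def h[symmetric] \<tau>_def by blast
    \<comment> \<open>The induction hypothesis speaks of the grid only; the boundary conditions carry the equality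
      over to the ghost cells.\<close>
    have \<rho>n: "grid_tendsto K (\<lambda>M. \<rho> M n) (\<rho>0 0) (at_right 0)"
    proof (rule reflecting_grid_tendsto[OF ev_bc(1)[OF le(1)]])
      show "reflecting_bc 1 K (\<rho>0 0)"
        using bc(1) by (simp add: neumann_bc_iff_reflecting)
      show "((\<lambda>M. \<rho> M n i j) \<longlongrightarrow> \<rho>0 0 i j) (at_right 0)" if "(i,j) \<in> grid K" for i j
        using grid_tendstoD(1)[OF lims(1)[OF le(1)] that] IH that by auto
    qed
    have mass: "\<rho>0 (Suc n) i j - \<rho>0 0 i j
        + \<tau> * div_h h (momentum_h (\<rho>0 (Suc n)) (v0 (Suc n))) i j = 0" if "(i,j) \<in> grid K" for i j
      by (rule mass_balance_limit[OF _ \<rho>n lims(1,2)[OF le(2)] that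
            eventually_mono[OF sol scheme_at[OF _ that, THEN conjunct2, THEN conjunct1]]]) simp
    have "(\<Sum>(i,j)\<in>grid K. \<rho>0 (Suc n) i j - \<rho>0 0 i j)
        = (\<Sum>(i,j)\<in>grid K. - \<tau> * div_h h (momentum_h (\<rho>0 (Suc n)) (v0 (Suc n))) i j)"
      using mass by (intro sum.cong) (auto simp: algebra_simps eq_neg_iff_add_eq_0)
    also have "\<dots> = - \<tau> * (\<Sum>(i,j)\<in>grid K. div_h h (momentum_h (\<rho>0 (Suc n)) (v0 (Suc n))) i j)"
      by (simp only: case_prod_unfold sum_distrib_left)
    also have "\<dots> = 0"
      using sum_div_eq_0[OF reflecting_bc_momentum] bc by simp
    finally have mean: "(\<Sum>(i,j)\<in>grid K. \<rho>0 (Suc n) i j - \<rho>0 0 i j) = 0" .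
    have "grad_h h (\<Lambda>0 (Suc n)) i j = 0" if "(i,j) \<in> grid K" for i j
    proof (rule momentum_balance_limit[OF \<rho>n lims(1)[OF le(2)] lims(2)[OF le(1)] lims(2,3)[OF le(2)] that
          _ _ eventually_mono[OF sol scheme_at[OF _ that, THEN conjunct2, THEN conjunct2, THEN conjunct1]]])
      show "\<rho>0 0 i j \<noteq> 0" "\<tau> \<noteq> 0"
        using init_pos that \<open>\<tau> > 0\<close> by auto
    qed
    then have \<Lambda>_const: "\<Lambda>0 (Suc n) i j = \<Lambda>0 (Suc n) 0 0" if "(i,j) \<in> grid K" for i j
      using grad_zero_imp_constant[OF bc(3) \<open>h \<noteq> 0\<close> _ that] by blast
    have eq: "\<rho>0 (Suc n) i j = \<rho>0 0 i j" if "(i,j) \<in> grid K" for i j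
    proof (rule equilibrium_persists[OF _ \<open>h \<noteq> 0\<close> \<gamma> UV bc(1,2) \<rho>n lims(1,3)[OF le(2)]
          _ _ _ \<Lambda>_const c mean that])
      show "0 < \<rho>0 0 k l" if "(k,l) \<in> grid K" for k l
        using init_pos that by auto
      show "\<forall>\<^sub>F M in at_right 0. 0 < \<rho> M (Suc n) k l" if "(k,l) \<in> grid K" for k l
        by (rule eventually_mono[OF sol scheme_at[OF _ that, THEN conjunct1]])
      show "\<forall>\<^sub>F M in at_right 0. \<Lambda> M (Suc n) k l - deriv U (\<rho> M (Suc n) k l)
          + deriv V (\<rho> M n k l) + \<gamma> * laplace_h h (\<rho> M (Suc n)) k l = 0"
        if "(k,l) \<in> grid K" for k l
        by (rule eventually_mono[OF sol scheme_at[OF _ that, THEN conjunct2, THEN conjunct2, THEN conjunct2]])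
    qed simp
    show ?thesis
      using eq mass \<open>\<tau> > 0\<close> by fastforce
  qed
  have "n \<le> N \<Longrightarrow> \<forall>(i,j)\<in>grid K. \<rho>0 n i j = \<rho>0 0 i j
      \<and> div_h h (momentum_h (\<rho>0 n) (v0 n)) i j = 0" for n
  proof (induction n)
    case 0
    then show ?case
      using init_div by auto
  next
    case (Suc n)
    then show ?case
      by (intro step) auto
  qed
  then show ?thesis
    by blast
qed

end
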